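(* Let $|\mathcal{M}|=1$. Adding the resource-demand branching constraints (D) to the pricing problems without resource constraints, i.e. $\min\{\hat c_n : (A_n), (P_n), x_{ijmt}\in\{0,1\}\}$, strengthens the master formulation beyond the compact formulation, i.e., $$z^{(D)}_{LP}\le z^{(D)}_{LMP},$$ where the inequality is strict in at least some case. Here $z^{(D)}_{LP}$ and $z^{(D)}_{LMP}$ are the optimal values of the linear relaxations of the compact formulation and of the master formulation, respectively, when the same branching constraints (D) are added to both formulations.
   Context: Instance. A set of projects $\mathcal{P}$ is scheduled over periods $\mathcal{T}=\{1,\dots,T\}$ using a shared pool of renewable resources $\mathcal{R}$. $\mathcal{V}$ is the set of all activities $(i,j)$ (activity $j$ of project $i$). $\mathcal{E}$ is the set of precedence relations $(i,j,j')$: activity $j'$ of project $i$ may start only after activity $j$ of project $i$ is finished. Each activity $(i,j)$ is processed without interruption in one of its modes $m\in\mathcal{M}_{ij}\subseteq\mathcal{M}$. In mode $m$ it has duration $d_{ijm}$, uses $r_{ijmk}$ units of resource $k$ in each period of processing, and costs $c_{ijmt}$ if started in period $t$. The capacity $R_k$ of resource $k$ is an integer decision between $\underline{R}_k$ and $\overline{R}_k$, with cost $c_k$ per unit. Terms with time indices outside $\mathcal{T}$ are absent from sums. Compact formulation (pulse disaggregated discrete-time). Minimize $\sum_{(i,j)\in\mathcal{V}}\sum_{m\in\mathcal{M}_{ij}}\sum_{t\in\mathcal{T}} c_{ijmt}x_{ijmt}+\sum_{k\in\mathcal{R}}c_kR_k$ subject to - $\sum_{m\in\mathcal{M}_{ij}}\sum_{t\in\mathcal{T}}x_{ijmt}=1$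 for all $(i,j)\in\mathcal{V}$; - $\sum_{m\in\mathcal{M}_{ij}}\sum_{s=t-d_{ijm}+1}^{T}x_{ijms}+\sum_{m\in\mathcal{M}_{ij'}}\sum_{s=1}^{t}x_{ij'ms}\le 1$ for all $(i,j,j')\in\mathcal{E}$, $t\in\mathcal{T}$ (disaggregated precedence constraints); - $\sum_{(i,j)\in\mathcal{V}}\sum_{m\in\mathcal{M}_{ij}}\sum_{s=t-d_{ijm}+1}^{t}r_{ijmk}x_{ijms}\le R_k$ for all $k\in\mathcal{R}$, $t\in\mathcal{T}$; - $x_{ijmt}\in\{0,1\}$, $R_k\in\{\underline{R}_k,\dots,\overline{R}_k\}$. Master formulation. Partition $\mathcal{V}$ into mutually exclusive and collectively exhaustive subsets $\mathcal{V}_1,\dots,\mathcal{V}_N$, $\mathcal{N}=\{1,\dots,N\}$. Let $\mathcal{E}_n$ be the precedence relations corresponding to the activities in $\mathcal{V}_n$, and $\Omega_n$ the set of potential schedules for $\mathcal{V}_n$. A schedule $\omega\in\Omega_n$ has start times $s_{ijn\omega}$ and finish times $f_{ijn\omega}$ for $(i,j)\in\mathcal{V}_n$, cost $c_{n\omega}$, demand $r_{knt\omega}$ for resource $k$ in period $t$, and peak demand $\overline{r}_{kn\omega}$ for resource $k$. With $\lambda_{n\omega}=1$ if schedule $\omega$ is used for $\mathcal{V}_n$ and $0$ otherwise, minimize $\sum_{n\in\mathcal{N}}\sum_{\omega\in\Omega_n}c_{n\omega}\lambda_{n\omega}+\sum_{k\in\mathcal{R}}c_kR_k$ subject to - (convexity,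 duals $\pi_n$) $\sum_{\omega\in\Omega_n}\lambda_{n\omega}=1$ for all $n\in\mathcal{N}$; - (aggregated cross-partition precedence, duals $\pi_{ijj'}$) $\sum_{n:(i,j)\in\mathcal{V}_n}\sum_{\omega\in\Omega_n}f_{ijn\omega}\lambda_{n\omega}\le\sum_{n:(i,j')\in\mathcal{V}_n}\sum_{\omega\in\Omega_n}s_{ij'n\omega}\lambda_{n\omega}$ for all $(i,j,j')\in\mathcal{E}\setminus\bigcup_{n\in\mathcal{N}}\mathcal{E}_n$; - (resource usage, duals $\pi_{kt}$) $\sum_{n\in\mathcal{N}}\sum_{\omega\in\Omega_n}r_{knt\omega}\lambda_{n\omega}\le R_k$ for all $k\in\mathcal{R}$, $t\in\mathcal{T}$; - (peak demand, duals $\pi_k$) $\sum_{n\in\mathcal{N}}\sum_{\omega\in\Omega_n}\overline{r}_{kn\omega}\lambda_{n\omega}\le R_k$ for all $k\in\mathcal{R}$; - $\lambda_{n\omega}\in\{0,1\}$, $R_k\in\{\underline{R}_k,\dots,\overline{R}_k\}$. Linear relaxations drop the integrality restrictions. Pricing problems without resource constraints. For each $n\in\mathcal{N}$, minimize the reduced cost $$\hat c_n=\sum_{(i,j)\in\mathcal{V}_n}\sum_{m\in\mathcal{M}_{ij}}\sum_{t\in\mathcal{T}}(c_{ijmt}-c^{\mathrm{prec}}_{ijt}-c^{\mathrm{res}}_{ijmt})x_{ijmt}+\sum_{k\in\mathcal{R}}(c_k-\pi_k)R_k-\pi_n,$$ where $c^{\mathrm{prec}}$ and $c^{\mathrm{res}}$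 collect the contributions of the dual values $\pi_{ijj'}$ and $\pi_{kt}$, respectively, subject to - ($A_n$) $\sum_{m\in\mathcal{M}_{ij}}\sum_{t\in\mathcal{T}}x_{ijmt}=1$ for all $(i,j)\in\mathcal{V}_n$; - ($P_n$) $\sum_{m\in\mathcal{M}_{ij}}\sum_{s=t-d_{ijm}+1}^{T}x_{ijms}+\sum_{m\in\mathcal{M}_{ij'}}\sum_{s=1}^{t}x_{ij'ms}\le1$ for all $(i,j,j')\in\mathcal{E}_n$, $t\in\mathcal{T}$; - $x_{ijmt}\in\{0,1\}$ for all $(i,j)\in\mathcal{V}_n$, $m\in\mathcal{M}_{ij}$, $t\in\mathcal{T}$. Resource-demand branching constraints (D). Let $$r_{knt}=\sum_{(i,j)\in\mathcal{V}_n}\sum_{m\in\mathcal{M}_{ij}}\sum_{s=t-d_{ijm}+1}^{t}r_{ijmk}x_{ijms},$$ and, for some fractional solution, let $r^*_{knt}$ be the demand of the activities in $\mathcal{V}_n$ for resource $k$ in period $t$. Branching removes the columns violating the branching decision from the master problem and adds to the pricing problems the constraint down-branch: $r_{knt}\le\lfloor r^*_{knt}\rfloor$; up-branch: $r_{knt}\ge\lceil r^*_{knt}\rceil$.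
   Formalization: The inequality fails if precedence relations cross parts, as the master only aggregates them. It is shown as stated when no relation crosses parts, and for every partition with the crossing relations aggregated in the compact relaxation too. *)

theory Defs
  imports Complex_Main "HOL-Library.Extended_Real"
begin

section \<open>Instances\<close>

text \<open>The activity \<open>(i, j)\<close> is activity \<open>j\<close> of project \<open>i\<close>; the triple \<open>(i, j, j')\<close> in \<open>precs\<close>
  says that \<open>(i, j')\<close> may start only after \<open>(i, j)\<close> is finished.\<close>

record ('i, 'j, 'm, 'k) scheduling =
  horizon   :: nat
  projects  :: "'i set"
  acts      :: "('i \<times> 'j) set"
  precs     :: "('i \<times> 'j \<times> 'j) set"
  resources :: "'k set"
  modes     :: "'m set"
  modes_of  :: "'i \<times> 'j \<Rightarrow> 'm set"
  dur       :: "'i \<times> 'j \<Rightarrow> 'm \<Rightarrow> nat"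
  usage     :: "'i \<times> 'j \<Rightarrow> 'm \<Rightarrow> 'k \<Rightarrow> nat"
  cost      :: "'i \<times> 'j \<Rightarrow> 'm \<Rightarrow> nat \<Rightarrow> real"
  cap_lo    :: "'k \<Rightarrow> nat"
  cap_hi    :: "'k \<Rightarrow> nat"
  cap_cost  :: "'k \<Rightarrow> real"

definition periods :: "('i, 'j, 'm, 'k) scheduling \<Rightarrow> nat set" where
  "periods I = {1..horizon I}"

definition valid_instance :: "('i, 'j, 'm, 'k) scheduling \<Rightarrow> bool" where
  "valid_instance I \<longleftrightarrow>
     horizon I \<ge> 1 \<and>
     finite (projects I) \<and> finite (acts I) \<and> finite (resources I) \<and> finite (modes I) \<and>
     fst ` acts I \<subseteq> projects I \<and>
     (\<forall>(i, j, j')\<in>precs I. (i, j) \<in> acts I \<and> (i, j') \<in> acts I) \<and>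
     (\<forall>a\<in>acts I. modes_of I a \<subseteq> modes I \<and> modes_of I a \<noteq> {}) \<and>
     (\<forall>k\<in>resources I. cap_lo I k \<le> cap_hi I k)"

section \<open>Pulse variables\<close>

text \<open>\<open>x a m t\<close> is the variable for starting activity \<open>a\<close> in mode \<open>m\<close> at period \<open>t\<close>. The lower
  summation limit \<open>s = t - d + 1\<close> is written \<open>t + 1 \<le> s + d\<close>, which avoids truncated subtraction
  and drops the terms with \<open>s < 1\<close>.\<close>

type_synonym ('i, 'j, 'm) pulse = "'i \<times> 'j \<Rightarrow> 'm \<Rightarrow> nat \<Rightarrow> real"

definition assignment ::
  "('i, 'j, 'm, 'k) scheduling \<Rightarrow> ('i \<times> 'j) set \<Rightarrow> ('i, 'j, 'm) pulse \<Rightarrow> bool" where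
  "assignment I A x \<longleftrightarrow> (\<forall>a\<in>A. (\<Sum>m\<in>modes_of I a. \<Sum>t\<in>periods I. x a m t) = 1)"

definition disaggregated_prec ::
  "('i, 'j, 'm, 'k) scheduling \<Rightarrow> ('i \<times> 'j \<times> 'j) set \<Rightarrow> ('i, 'j, 'm) pulse \<Rightarrow> bool" where
  "disaggregated_prec I F x \<longleftrightarrow> (\<forall>(i, j, j')\<in>F. \<forall>t\<in>periods I.
     (\<Sum>m\<in>modes_of I (i, j). \<Sum>s\<in>{s\<in>periods I. t + 1 \<le> s + dur I (i, j) m}. x (i, j) m s)
     + (\<Sum>m\<in>modes_of I (i, j'). \<Sum>s\<in>{s\<in>periods I. s \<le> t}. x (i, j') m s) \<le> 1)"

definition demand ::
  "('i, 'j, 'm, 'k) scheduling \<Rightarrow> ('i \<times> 'j) set \<Rightarrow> 'k \<Rightarrow> nat \<Rightarrow> ('i, 'j, 'm) pulse \<Rightarrow> real" where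
  "demand I A k t x = (\<Sum>a\<in>A. \<Sum>m\<in>modes_of I a.
     \<Sum>s\<in>{s\<in>periods I. t + 1 \<le> s + dur I a m \<and> s \<le> t}. real (usage I a m k) * x a m s)"

definition schedule_cost ::
  "('i, 'j, 'm, 'k) scheduling \<Rightarrow> ('i \<times> 'j) set \<Rightarrow> ('i, 'j, 'm) pulse \<Rightarrow> real" where
  "schedule_cost I A x = (\<Sum>a\<in>A. \<Sum>m\<in>modes_of I a. \<Sum>t\<in>periods I. cost I a m t * x a m t)"

text \<open>An activity started in period \<open>t\<close> occupies the periods \<open>t, ..., t + d - 1\<close>. Its finish time is
  \<open>t + d\<close>, so that \<open>finish \<le> start\<close> is the precedence condition.\<close>

definition start_time ::
  "('i, 'j, 'm, 'k) scheduling \<Rightarrow> 'i \<times> 'j \<Rightarrow> ('i, 'j, 'm) pulse \<Rightarrow> real" where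
  "start_time I a x = (\<Sum>m\<in>modes_of I a. \<Sum>t\<in>periods I. real t * x a m t)"

definition finish_time ::
  "('i, 'j, 'm, 'k) scheduling \<Rightarrow> 'i \<times> 'j \<Rightarrow> ('i, 'j, 'm) pulse \<Rightarrow> real" where
  "finish_time I a x = (\<Sum>m\<in>modes_of I a. \<Sum>t\<in>periods I. real (t + dur I a m) * x a m t)"

section \<open>Partitions and branching constraints\<close>

definition is_partition ::
  "('i, 'j, 'm, 'k) scheduling \<Rightarrow> nat \<Rightarrow> (nat \<Rightarrow> ('i \<times> 'j) set) \<Rightarrow> bool" where
  "is_partition I N V \<longleftrightarrow> (\<Union>n\<in>{1..N}. V n) = acts I \<and>
     (\<forall>n\<in>{1..N}. \<forall>n'\<in>{1..N}. n \<noteq> n' \<longrightarrow> V n \<inter> V n' = {})"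

definition precs_within ::
  "('i, 'j, 'm, 'k) scheduling \<Rightarrow> ('i \<times> 'j) set \<Rightarrow> ('i \<times> 'j \<times> 'j) set" where
  "precs_within I A = {(i, j, j'). (i, j, j') \<in> precs I \<and> (i, j) \<in> A \<and> (i, j') \<in> A}"

definition cross_precs ::
  "('i, 'j, 'm, 'k) scheduling \<Rightarrow> nat \<Rightarrow> (nat \<Rightarrow> ('i \<times> 'j) set) \<Rightarrow> ('i \<times> 'j \<times> 'j) set" where
  "cross_precs I N V = precs I - (\<Union>n\<in>{1..N}. precs_within I (V n))"

text \<open>\<open>Down k n t r\<close> and \<open>Up k n t r\<close> are the two branches obtained from the value \<open>r\<close> of the demand
  of \<open>V n\<close> for resource \<open>k\<close> in period \<open>t\<close>.\<close>

datatype 'k branching = Down 'k (part: nat) nat real | Up 'k (part: nat) nat real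

fun satisfies_branching ::
  "('i, 'j, 'm, 'k) scheduling \<Rightarrow> (nat \<Rightarrow> ('i \<times> 'j) set) \<Rightarrow> 'k branching \<Rightarrow>
   ('i, 'j, 'm) pulse \<Rightarrow> bool" where
  "satisfies_branching I V (Down k n t r) x \<longleftrightarrow> demand I (V n) k t x \<le> of_int \<lfloor>r\<rfloor>"
| "satisfies_branching I V (Up k n t r) x \<longleftrightarrow> demand I (V n) k t x \<ge> of_int \<lceil>r\<rceil>"

definition branchings :: "('i, 'j, 'm, 'k) scheduling \<Rightarrow> nat \<Rightarrow> 'k branching set" where
  "branchings I N = {b. \<exists>k\<in>resources I. \<exists>n\<in>{1..N}. \<exists>t\<in>periods I. \<exists>r.
     b = Down k n t r \<or> b = Up k n t r}"

section \<open>Linear relaxation of the compact formulation\<close>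

text \<open>The constraints other than precedence.\<close>

definition compact_base ::
  "('i, 'j, 'm, 'k) scheduling \<Rightarrow> (nat \<Rightarrow> ('i \<times> 'j) set) \<Rightarrow> 'k branching set \<Rightarrow>
   ('i, 'j, 'm) pulse \<Rightarrow> ('k \<Rightarrow> real) \<Rightarrow> bool" where
  "compact_base I V D x R \<longleftrightarrow>
     assignment I (acts I) x \<and>
     (\<forall>k\<in>resources I. \<forall>t\<in>periods I. demand I (acts I) k t x \<le> R k) \<and>
     (\<forall>b\<in>D. satisfies_branching I V b x) \<and>
     (\<forall>a\<in>acts I. \<forall>m\<in>modes_of I a. \<forall>t\<in>periods I. 0 \<le> x a m t \<and> x a m t \<le> 1) \<and>
     (\<forall>k\<in>resources I. real (cap_lo I k) \<le> R k \<and> R k \<le> real (cap_hi I k))"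

definition lp_feasible ::
  "('i, 'j, 'm, 'k) scheduling \<Rightarrow> (nat \<Rightarrow> ('i \<times> 'j) set) \<Rightarrow> 'k branching set \<Rightarrow>
   ('i, 'j, 'm) pulse \<Rightarrow> ('k \<Rightarrow> real) \<Rightarrow> bool" where
  "lp_feasible I V D x R \<longleftrightarrow> compact_base I V D x R \<and> disaggregated_prec I (precs I) x"

definition compact_cost ::
  "('i, 'j, 'm, 'k) scheduling \<Rightarrow> ('i, 'j, 'm) pulse \<Rightarrow> ('k \<Rightarrow> real) \<Rightarrow> real" where
  "compact_cost I x R = schedule_cost I (acts I) x + (\<Sum>k\<in>resources I. cap_cost I k * R k)"

text \<open>Optimal values are infima in the extended reals; an infeasible program has value \<open>\<infinity>\<close>.\<close>

definition z_LP ::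
  "('i, 'j, 'm, 'k) scheduling \<Rightarrow> (nat \<Rightarrow> ('i \<times> 'j) set) \<Rightarrow> 'k branching set \<Rightarrow> ereal" where
  "z_LP I V D = Inf {ereal (compact_cost I x R) | x R. lp_feasible I V D x R}"

text \<open>The variant in which the precedence relations across parts are imposed in the aggregated form
  that the master formulation uses. It coincides with \<open>z_LP\<close> if no relation crosses parts. If some
  relation does, its disaggregated form cuts off points that the aggregated form admits, and
  \<open>z_LP\<close> may exceed the value of the master relaxation for that reason alone.\<close>

definition lp_cross_aggregated_feasible ::
  "('i, 'j, 'm, 'k) scheduling \<Rightarrow> nat \<Rightarrow> (nat \<Rightarrow> ('i \<times> 'j) set) \<Rightarrow> 'k branching set \<Rightarrow>
   ('i, 'j, 'm) pulse \<Rightarrow> ('k \<Rightarrow> real) \<Rightarrow> bool" where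
  "lp_cross_aggregated_feasible I N V D x R \<longleftrightarrow> compact_base I V D x R \<and>
     disaggregated_prec I (\<Union>n\<in>{1..N}. precs_within I (V n)) x \<and>
     (\<forall>(i, j, j')\<in>cross_precs I N V. finish_time I (i, j) x \<le> start_time I (i, j') x)"

definition z_LP_cross_aggregated ::
  "('i, 'j, 'm, 'k) scheduling \<Rightarrow> nat \<Rightarrow> (nat \<Rightarrow> ('i \<times> 'j) set) \<Rightarrow> 'k branching set \<Rightarrow> ereal" where
  "z_LP_cross_aggregated I N V D =
     Inf {ereal (compact_cost I x R) | x R. lp_cross_aggregated_feasible I N V D x R}"

section \<open>Linear relaxation of the master formulation\<close>

text \<open>The columns for part \<open>n\<close> are the feasible solutions of its pricing problem without resource
  constraints. They vanish off the index set, so that distinct columns are distinct schedules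
  and there are only finitely many.\<close>

definition columns ::
  "('i, 'j, 'm, 'k) scheduling \<Rightarrow> (nat \<Rightarrow> ('i \<times> 'j) set) \<Rightarrow> 'k branching set \<Rightarrow> nat \<Rightarrow>
   ('i, 'j, 'm) pulse set" where
  "columns I V D n = {x.
     (\<forall>a m t. x a m t \<in> {0, 1}) \<and>
     (\<forall>a m t. \<not> (a \<in> V n \<and> m \<in> modes_of I a \<and> t \<in> periods I) \<longrightarrow> x a m t = 0) \<and>
     assignment I (V n) x \<and>
     disaggregated_prec I (precs_within I (V n)) x \<and>
     (\<forall>b\<in>D. part b = n \<longrightarrow> satisfies_branching I V b x)}"

definition peak_demand ::
  "('i, 'j, 'm, 'k) scheduling \<Rightarrow> ('i \<times> 'j) set \<Rightarrow> 'k \<Rightarrow> ('i, 'j, 'm) pulse \<Rightarrow> real" where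
  "peak_demand I A k x = Max ((\<lambda>t. demand I A k t x) ` periods I)"

definition lmp_feasible ::
  "('i, 'j, 'm, 'k) scheduling \<Rightarrow> nat \<Rightarrow> (nat \<Rightarrow> ('i \<times> 'j) set) \<Rightarrow> 'k branching set \<Rightarrow>
   (nat \<Rightarrow> ('i, 'j, 'm) pulse \<Rightarrow> real) \<Rightarrow> ('k \<Rightarrow> real) \<Rightarrow> bool" where
  "lmp_feasible I N V D l R \<longleftrightarrow>
     (\<forall>n\<in>{1..N}. (\<Sum>w\<in>columns I V D n. l n w) = 1) \<and>
     (\<forall>(i, j, j')\<in>cross_precs I N V.
        (\<Sum>n\<in>{n\<in>{1..N}. (i, j) \<in> V n}. \<Sum>w\<in>columns I V D n. finish_time I (i, j) w * l n w)
        \<le> (\<Sum>n\<in>{n\<in>{1..N}. (i, j') \<in> V n}. \<Sum>w\<in>columns I V D n. start_time I (i, j') w * l n w)) \<and>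
     (\<forall>k\<in>resources I. \<forall>t\<in>periods I.
        (\<Sum>n\<in>{1..N}. \<Sum>w\<in>columns I V D n. demand I (V n) k t w * l n w) \<le> R k) \<and>
     (\<forall>k\<in>resources I.
        (\<Sum>n\<in>{1..N}. \<Sum>w\<in>columns I V D n. peak_demand I (V n) k w * l n w) \<le> R k) \<and>
     (\<forall>n\<in>{1..N}. \<forall>w\<in>columns I V D n. 0 \<le> l n w \<and> l n w \<le> 1) \<and>
     (\<forall>k\<in>resources I. real (cap_lo I k) \<le> R k \<and> R k \<le> real (cap_hi I k))"

definition master_cost ::
  "('i, 'j, 'm, 'k) scheduling \<Rightarrow> nat \<Rightarrow> (nat \<Rightarrow> ('i \<times> 'j) set) \<Rightarrow> 'k branching set \<Rightarrow>
   (nat \<Rightarrow> ('i, 'j, 'm) pulse \<Rightarrow> real) \<Rightarrow> ('k \<Rightarrow> real) \<Rightarrow> real" where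
  "master_cost I N V D l R =
     (\<Sum>n\<in>{1..N}. \<Sum>w\<in>columns I V D n. schedule_cost I (V n) w * l n w)
     + (\<Sum>k\<in>resources I. cap_cost I k * R k)"

definition z_LMP ::
  "('i, 'j, 'm, 'k) scheduling \<Rightarrow> nat \<Rightarrow> (nat \<Rightarrow> ('i \<times> 'j) set) \<Rightarrow> 'k branching set \<Rightarrow> ereal" where
  "z_LMP I N V D = Inf {ereal (master_cost I N V D l R) | l R. lmp_feasible I N V D l R}"

section \<open>Branching on fractional solutions\<close>

text \<open>The sets of branching constraints that arise in the search tree: at each node the value
  branched on is the demand of a part in a fractional feasible solution of the linear relaxation
  of the master formulation at that node.\<close>

inductive branching_node ::
  "('i, 'j, 'm, 'k) scheduling \<Rightarrow> nat \<Rightarrow> (nat \<Rightarrow> ('i \<times> 'j) set) \<Rightarrow> 'k branching set \<Rightarrow> bool"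
  for I :: "('i, 'j, 'm, 'k) scheduling" and N :: nat and V :: "nat \<Rightarrow> ('i \<times> 'j) set" where
  root: "branching_node I N V {}"
| branch: "branching_node I N V (insert b D)"
    if "branching_node I N V D" and "lmp_feasible I N V D l R"
      and "\<exists>n'\<in>{1..N}. \<exists>w\<in>columns I V D n'. l n' w \<notin> {0, 1}"
      and "k \<in> resources I" and "n \<in> {1..N}" and "t \<in> periods I"
      and "r = (\<Sum>w\<in>columns I V D n. demand I (V n) k t w * l n w)"
      and "b = Down k n t r \<or> b = Up k n t r"

end

theory Submission
  imports Defs
begin

text \<open>A point of the master relaxation assigns to every part a convex combination of its columns.
  Let \<open>x\<close> be the pulse vector that averages, on each part, the columns with these weights.
  Assignment, demand, cost, start and finish times and both sides of the precedence constraints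
  are linear in the pulses, so their value at \<open>x\<close> is the weighted average of their values on the
  columns (\<open>column_mixture_linear\<close>). A column satisfies the assignment, internal precedence and
  branching constraints of its part, hence so does \<open>x\<close>; the resource and cross-part precedence
  constraints of the master formulation turn literally into constraints on \<open>x\<close>. Thus \<open>x\<close> is
  feasible for the compact relaxation, with cross-part precedence aggregated, at the same cost
  (\<open>column_mixture_feasible\<close>, \<open>column_mixture_cost\<close>). If no relation crosses parts, aggregation
  changes nothing and \<open>x\<close> is feasible for the compact relaxation itself.

  The inequality can be strict because a column satisfies the branching constraint as an integral
  point, whereas in the compact relaxation the constraint is just one more half-space. One activity
  of duration one that uses two units and may start in period 1 at cost 0 or in period 2 at cost 1
  shows this. From a demand of \<open>3/2\<close> in period 1 the down-branch requires a demand of at most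
  one there, which excludes the column that starts in period 1 and forces cost 1, while the
  compact relaxation still starts half of the activity in period 1 and pays only \<open>1/2\<close>.
  Before branching both relaxations have value 0.\<close>

section \<open>Averaging the columns of a master solution\<close>

text \<open>In a partition the outer sum selects the one part that contains the activity.\<close>

definition column_mixture ::
  "('i, 'j, 'm, 'k) scheduling \<Rightarrow> nat \<Rightarrow> (nat \<Rightarrow> ('i \<times> 'j) set) \<Rightarrow> 'k branching set \<Rightarrow>
   (nat \<Rightarrow> ('i, 'j, 'm) pulse \<Rightarrow> real) \<Rightarrow> ('i, 'j, 'm) pulse" where
  "column_mixture I N V D l a m t =
     (\<Sum>n\<in>{n\<in>{1..N}. a \<in> V n}. \<Sum>w\<in>columns I V D n. w a m t * l n w)"

lemma parts_containing:
  assumes "is_partition I N V" "n \<in> {1..N}" "a \<in> V n"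
  shows "{n'\<in>{1..N}. a \<in> V n'} = {n}"
  using assms unfolding is_partition_def by blast

lemma column_mixture_on_part:
  assumes "is_partition I N V" "n \<in> {1..N}" "a \<in> V n"
  shows "column_mixture I N V D l a m t = (\<Sum>w\<in>columns I V D n. w a m t * l n w)"
  unfolding column_mixture_def parts_containing[OF assms] by simp

lemma sum_acts_by_part:
  assumes "is_partition I N V" "finite (acts I)"
  shows "sum f (acts I) = (\<Sum>n\<in>{1..N}. sum f (V n))"
proof -
  have U: "acts I = (\<Union>n\<in>{1..N}. V n)"
    using assms(1) by (simp add: is_partition_def)
  have "finite (V n)" if "n \<in> {1..N}" for n
    using that assms(2) U by (auto intro: finite_subset)
  then show ?thesis
    unfolding U using assms(1) by (intro sum.UNION_disjoint) (auto simp: is_partition_def)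
qed

text \<open>Every functional of the formulations has this form on a single part, for suitable index sets
  and coefficients.\<close>

lemma column_mixture_linear:
  fixes c :: "'i \<times> 'j \<Rightarrow> 'm \<Rightarrow> nat \<Rightarrow> real"
  assumes "is_partition I N V" "n \<in> {1..N}" "A \<subseteq> V n"
  shows "(\<Sum>a\<in>A. \<Sum>m\<in>M a. \<Sum>s\<in>S a m. c a m s * column_mixture I N V D l a m s)
       = (\<Sum>w\<in>columns I V D n. (\<Sum>a\<in>A. \<Sum>m\<in>M a. \<Sum>s\<in>S a m. c a m s * w a m s) * l n w)"
proof -
  have swap: "(\<Sum>i\<in>B. \<Sum>w\<in>W. g i w * h w) = (\<Sum>w\<in>W. (\<Sum>i\<in>B. g i w) * h w)"
    for B :: "'b set" and W :: "('i, 'j, 'm) pulse set" and g and h :: "_ \<Rightarrow> real"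
    by (subst sum.swap) (simp add: sum_distrib_right)
  have "(\<Sum>a\<in>A. \<Sum>m\<in>M a. \<Sum>s\<in>S a m. c a m s * column_mixture I N V D l a m s)
      = (\<Sum>a\<in>A. \<Sum>m\<in>M a. \<Sum>s\<in>S a m. \<Sum>w\<in>columns I V D n. (c a m s * w a m s) * l n w)"
    using assms
    by (intro sum.cong refl)
       (auto simp: column_mixture_on_part[OF assms(1,2)] sum_distrib_left mult.assoc)
  then show ?thesis
    by (simp only: swap)
qed

lemma weighted_average_le:
  fixes f l :: "'w \<Rightarrow> real"
  assumes "(\<Sum>w\<in>W. l w) = 1" "\<And>w. w \<in> W \<Longrightarrow> 0 \<le> l w" "\<And>w. w \<in> W \<Longrightarrow> f w \<le> B"
  shows "(\<Sum>w\<in>W. f w * l w) \<le> B"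
proof -
  have "(\<Sum>w\<in>W. f w * l w) \<le> (\<Sum>w\<in>W. B * l w)"
    using assms(2,3) by (intro sum_mono mult_right_mono)
  also have "\<dots> = B"
    by (simp add: sum_distrib_left[symmetric] assms(1))
  finally show ?thesis .
qed

lemma weighted_average_ge:
  fixes f l :: "'w \<Rightarrow> real"
  assumes "(\<Sum>w\<in>W. l w) = 1" "\<And>w. w \<in> W \<Longrightarrow> 0 \<le> l w" "\<And>w. w \<in> W \<Longrightarrow> B \<le> f w"
  shows "B \<le> (\<Sum>w\<in>W. f w * l w)"
  using weighted_average_le[of l W "\<lambda>w. - f w" "- B"] assms by (simp add: sum_negf)

lemma column_mixture_demand:
  assumes "is_partition I N V" "n \<in> {1..N}"
  shows "demand I (V n) k t (column_mixture I N V D l)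
       = (\<Sum>w\<in>columns I V D n. demand I (V n) k t w * l n w)"
  unfolding demand_def using assms by (intro column_mixture_linear) auto

lemma column_mixture_schedule_cost:
  assumes "is_partition I N V" "n \<in> {1..N}"
  shows "schedule_cost I (V n) (column_mixture I N V D l)
       = (\<Sum>w\<in>columns I V D n. schedule_cost I (V n) w * l n w)"
  unfolding schedule_cost_def using assms by (intro column_mixture_linear) auto

lemma column_mixture_start_time:
  assumes "is_partition I N V" "n \<in> {1..N}" "a \<in> V n"
  shows "start_time I a (column_mixture I N V D l)
       = (\<Sum>w\<in>columns I V D n. start_time I a w * l n w)"
  using column_mixture_linear[OF assms(1,2), of "{a}" "\<lambda>_ _ t. real t" D l
      "\<lambda>_ _. periods I" "modes_of I"] assms(3)
  by (simp add: start_time_def)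

lemma column_mixture_finish_time:
  assumes "is_partition I N V" "n \<in> {1..N}" "a \<in> V n"
  shows "finish_time I a (column_mixture I N V D l)
       = (\<Sum>w\<in>columns I V D n. finish_time I a w * l n w)"
  using column_mixture_linear[OF assms(1,2), of "{a}" "\<lambda>a m t. real (t + dur I a m)" D l
      "\<lambda>_ _. periods I" "modes_of I"] assms(3)
  by (simp add: finish_time_def)

lemma column_mixture_pulse_sum:
  assumes "is_partition I N V" "n \<in> {1..N}" "a \<in> V n"
  shows "(\<Sum>m\<in>modes_of I a. \<Sum>s\<in>S m. column_mixture I N V D l a m s)
       = (\<Sum>w\<in>columns I V D n. (\<Sum>m\<in>modes_of I a. \<Sum>s\<in>S m. w a m s) * l n w)"
  using column_mixture_linear[OF assms(1,2), of "{a}" "\<lambda>_ _ _. 1" D l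
      "\<lambda>_. S" "modes_of I"] assms(3)
  by simp

lemma column_mixture_cost:
  assumes "is_partition I N V" "finite (acts I)"
  shows "compact_cost I (column_mixture I N V D l) R = master_cost I N V D l R"
proof -
  have "schedule_cost I (acts I) (column_mixture I N V D l)
      = (\<Sum>n\<in>{1..N}. schedule_cost I (V n) (column_mixture I N V D l))"
    unfolding schedule_cost_def by (rule sum_acts_by_part[OF assms])
  also have "\<dots> = (\<Sum>n\<in>{1..N}. \<Sum>w\<in>columns I V D n. schedule_cost I (V n) w * l n w)"
    by (intro sum.cong refl column_mixture_schedule_cost assms(1))
  finally show ?thesis
    by (simp add: compact_cost_def master_cost_def)
qed

text \<open>Branching constraints bound the demand of a single part, so they are inherited from its columns.
  For cross-part precedence no single column is informative; there the aggregated master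
  constraint itself bounds the averaged finish time by the averaged start time.\<close>

lemma column_mixture_feasible:
  assumes part: "is_partition I N V" and fin: "finite (acts I)"
    and wf: "\<forall>(i, j, j')\<in>precs I. (i, j) \<in> acts I \<and> (i, j') \<in> acts I"
    and D: "D \<subseteq> branchings I N" and feas: "lmp_feasible I N V D l R"
  shows "lp_cross_aggregated_feasible I N V D (column_mixture I N V D l) R"
proof -
  let ?x = "column_mixture I N V D l"
  note avg_le = weighted_average_le[where W = "columns I V D n" and l = "l n" for n]
  note avg_ge = weighted_average_ge[where W = "columns I V D n" and l = "l n" for n]
  have conv: "(\<Sum>w\<in>columns I V D n. l n w) = 1" if "n \<in> {1..N}" for n
    using feas that by (simp add: lmp_feasible_def)
  have nonneg: "0 \<le> l n w" if "n \<in> {1..N}" "w \<in> columns I V D n" for n w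
    using feas that by (simp add: lmp_feasible_def)
  have part_of: "\<exists>n\<in>{1..N}. a \<in> V n" if "a \<in> acts I" for a
    using part that unfolding is_partition_def by blast

  have "assignment I (acts I) ?x"
    unfolding assignment_def
  proof
    fix a assume "a \<in> acts I"
    then obtain n where n: "n \<in> {1..N}" "a \<in> V n" using part_of by blast
    have "(\<Sum>m\<in>modes_of I a. \<Sum>t\<in>periods I. ?x a m t)
        = (\<Sum>w\<in>columns I V D n. (\<Sum>m\<in>modes_of I a. \<Sum>t\<in>periods I. w a m t) * l n w)"
      by (rule column_mixture_pulse_sum[OF part n])
    also have "\<dots> = (\<Sum>w\<in>columns I V D n. l n w)"
      using n(2) by (intro sum.cong refl) (auto simp: columns_def assignment_def)
    finally show "(\<Sum>m\<in>modes_of I a. \<Sum>t\<in>periods I. ?x a m t) = 1"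
      using conv n(1) by simp
  qed
  moreover have "demand I (acts I) k t ?x \<le> R k"
    if "k \<in> resources I" "t \<in> periods I" for k t
  proof -
    have "demand I (acts I) k t ?x = (\<Sum>n\<in>{1..N}. demand I (V n) k t ?x)"
      unfolding demand_def by (rule sum_acts_by_part[OF part fin])
    also have "\<dots> = (\<Sum>n\<in>{1..N}. \<Sum>w\<in>columns I V D n. demand I (V n) k t w * l n w)"
      by (intro sum.cong refl column_mixture_demand part)
    also have "\<dots> \<le> R k"
      using feas that by (simp add: lmp_feasible_def)
    finally show ?thesis .
  qed
  moreover have "satisfies_branching I V b ?x" if "b \<in> D" for b
  proof -
    have "b \<in> branchings I N" using D that by blast
    then have n: "part b \<in> {1..N}"
      by (auto simp: branchings_def)
    have col: "satisfies_branching I V b w" if "w \<in> columns I V D (part b)" for w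
      using \<open>b \<in> D\<close> that by (auto simp: columns_def)
    show ?thesis
    proof (cases b)
      case (Down k n t r)
      then show ?thesis
        using n col nonneg by (auto simp: column_mixture_demand[OF part] conv intro!: avg_le)
    next
      case (Up k n t r)
      then show ?thesis
        using n col nonneg by (auto simp: column_mixture_demand[OF part] conv intro!: avg_ge)
    qed
  qed
  moreover have "0 \<le> ?x a m t \<and> ?x a m t \<le> 1" if a: "a \<in> acts I" for a m t
  proof -
    obtain n where n: "n \<in> {1..N}" "a \<in> V n" using part_of a by blast
    have w: "0 \<le> w a m t \<and> w a m t \<le> 1" if "w \<in> columns I V D n" for w
    proof -
      have "w a m t \<in> {0, 1}" using that unfolding columns_def by blast
      then show ?thesis by auto
    qed
    show ?thesis
      unfolding column_mixture_on_part[OF part n]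
      using avg_le[OF conv[OF n(1)]] avg_ge[OF conv[OF n(1)]] nonneg[OF n(1)] w by auto
  qed
  ultimately have base: "compact_base I V D ?x R"
    using feas by (simp add: compact_base_def lmp_feasible_def)

  have "disaggregated_prec I (\<Union>n\<in>{1..N}. precs_within I (V n)) ?x"
    unfolding disaggregated_prec_def
  proof (clarify)
    fix i j j' n t
    assume n: "n \<in> {1..N}" and e: "(i, j, j') \<in> precs_within I (V n)" and t: "t \<in> periods I"
    let ?L = "\<lambda>x. \<Sum>m\<in>modes_of I (i, j).
        \<Sum>s\<in>{s\<in>periods I. t + 1 \<le> s + dur I (i, j) m}. x (i, j) m s"
    let ?L' = "\<lambda>x. \<Sum>m\<in>modes_of I (i, j'). \<Sum>s\<in>{s\<in>periods I. s \<le> t}. x (i, j') m s"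
    have a: "(i, j) \<in> V n" "(i, j') \<in> V n"
      using e by (auto simp: precs_within_def)
    have "?L ?x + ?L' ?x = (\<Sum>w\<in>columns I V D n. (?L w + ?L' w) * l n w)"
      by (simp add: column_mixture_pulse_sum[OF part n] a sum.distrib distrib_right)
    also have "\<dots> \<le> 1"
      using e t
      by (intro avg_le conv nonneg n) (fastforce simp: columns_def disaggregated_prec_def)+
    finally show "?L ?x + ?L' ?x \<le> 1" .
  qed
  moreover have "finish_time I (i, j) ?x \<le> start_time I (i, j') ?x"
    if e: "(i, j, j') \<in> cross_precs I N V" for i j j'
  proof -
    have "(i, j) \<in> acts I" "(i, j') \<in> acts I"
      using wf e by (auto simp: cross_precs_def)
    then obtain n n' where n: "n \<in> {1..N}" "(i, j) \<in> V n" and n': "n' \<in> {1..N}" "(i, j') \<in> V n'"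
      using part_of by meson
    have "(\<Sum>n\<in>{n\<in>{1..N}. (i, j) \<in> V n}. \<Sum>w\<in>columns I V D n. finish_time I (i, j) w * l n w)
        \<le> (\<Sum>n\<in>{n\<in>{1..N}. (i, j') \<in> V n}. \<Sum>w\<in>columns I V D n. start_time I (i, j') w * l n w)"
      using feas e unfolding lmp_feasible_def by blast
    then show ?thesis
      unfolding parts_containing[OF part n] parts_containing[OF part n']
      by (simp add: column_mixture_finish_time[OF part n] column_mixture_start_time[OF part n'])
  qed
  ultimately show ?thesis
    using base by (auto simp: lp_cross_aggregated_feasible_def)
qed

lemma z_LP_cross_aggregated_le_z_LMP:
  assumes "valid_instance I" "is_partition I N V" "D \<subseteq> branchings I N"
  shows "z_LP_cross_aggregated I N V D \<le> z_LMP I N V D"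
proof -
  have wf: "finite (acts I)" "\<forall>(i, j, j')\<in>precs I. (i, j) \<in> acts I \<and> (i, j') \<in> acts I"
    using assms(1) by (auto simp: valid_instance_def)
  show ?thesis
    unfolding z_LP_cross_aggregated_def z_LMP_def
  proof (rule Inf_superset_mono, clarify)
    fix l R assume "lmp_feasible I N V D l R"
    then have "lp_cross_aggregated_feasible I N V D (column_mixture I N V D l) R"
      by (rule column_mixture_feasible[OF assms(2) wf assms(3)])
    then show "\<exists>x R'. ereal (master_cost I N V D l R) = ereal (compact_cost I x R')
        \<and> lp_cross_aggregated_feasible I N V D x R'"
      using column_mixture_cost[OF assms(2) wf(1), of D l R] by metis
  qed
qed

lemma z_LP_eq_z_LP_cross_aggregated:
  assumes "cross_precs I N V = {}"
  shows "z_LP I V D = z_LP_cross_aggregated I N V D"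
proof -
  have "(\<Union>n\<in>{1..N}. precs_within I (V n)) = precs I"
    using assms by (auto simp: cross_precs_def precs_within_def)
  then show ?thesis
    using assms
    by (simp add: z_LP_def z_LP_cross_aggregated_def lp_feasible_def lp_cross_aggregated_feasible_def)
qed

section \<open>An instance with a strict gap\<close>

text \<open>The capacity is fixed at the usage of the only activity, so that neither the resource
  constraints nor the peak demand constraints separate the two relaxations before branching.\<close>

definition gap_instance :: "(nat, nat, nat, nat) scheduling" where
  "gap_instance = \<lparr>horizon = 2, projects = {0}, acts = {(0, 0)}, precs = {}, resources = {0},
     modes = {0}, modes_of = (\<lambda>_. {0}), dur = (\<lambda>_ _. 1), usage = (\<lambda>_ _ _. 2),
     cost = (\<lambda>_ _ t. real t - 1), cap_lo = (\<lambda>_. 2), cap_hi = (\<lambda>_. 2), cap_cost = (\<lambda>_. 0)\<rparr>"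

definition gap_parts :: "nat \<Rightarrow> (nat \<times> nat) set" where
  "gap_parts = (\<lambda>_. {(0, 0)})"

text \<open>Any \<open>r\<close> with \<open>1 \<le> r < 2\<close> yields the same half-space; \<open>3/2\<close> is a demand that a fractional
  master solution attains.\<close>

definition gap_branch :: "nat branching" where
  "gap_branch = Down 0 1 1 (3/2)"

definition start_at :: "nat \<Rightarrow> (nat, nat, nat) pulse" where
  "start_at t0 a m t = (if a = (0, 0) \<and> m = 0 \<and> t = t0 then 1 else 0)"

lemma gap_periods: "periods gap_instance = {1, 2}"
  by (auto simp: periods_def gap_instance_def)

lemma gap_simps [simp]:
  "acts gap_instance = {(0, 0)}" "precs gap_instance = {}" "resources gap_instance = {0}"
  "modes_of gap_instance a = {0}" "dur gap_instance a m = 1" "usage gap_instance a m k = 2"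
  "cost gap_instance a m t = real t - 1" "cap_lo gap_instance k = 2" "cap_hi gap_instance k = 2"
  "cap_cost gap_instance k = 0" "gap_parts n = {(0, 0)}"
  by (simp_all add: gap_instance_def gap_parts_def)

lemma gap_valid:
  "valid_instance gap_instance" "card (modes gap_instance) = 1"
  "is_partition gap_instance 1 gap_parts" "cross_precs gap_instance 1 gap_parts = {}"
  by (auto simp: valid_instance_def is_partition_def cross_precs_def)
     (auto simp: gap_instance_def)

lemma gap_demand:
  assumes "t \<in> periods gap_instance"
  shows "demand gap_instance {(0, 0)} 0 t x = 2 * x (0, 0) 0 t"
proof -
  have "{s\<in>periods gap_instance. t + 1 \<le> s + 1 \<and> s \<le> t} = {t}"
    using assms by auto
  then show ?thesis by (simp add: demand_def)
qed

lemma gap_demand_1: "demand gap_instance {(0, 0)} 0 (Suc 0) x = 2 * x (0, 0) 0 1"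
  using gap_demand[of 1 x] by (simp add: gap_periods)

lemma gap_demand_2: "demand gap_instance {(0, 0)} 0 2 x = 2 * x (0, 0) 0 2"
  using gap_demand[of 2 x] by (simp add: gap_periods)

lemma gap_schedule_cost: "schedule_cost gap_instance {(0, 0)} x = x (0, 0) 0 2"
  by (simp add: schedule_cost_def gap_periods)

lemma gap_peak_demand:
  "peak_demand gap_instance {(0, 0)} 0 x = max (2 * x (0, 0) 0 1) (2 * x (0, 0) 0 2)"
  by (simp add: peak_demand_def gap_periods gap_demand_1 gap_demand_2)

lemma start_at_neq: "start_at 1 \<noteq> start_at 2"
proof
  assume "start_at 1 = start_at 2"
  then have "start_at 1 (0, 0) 0 1 = start_at 2 (0, 0) 0 1" by simp
  then show False by (simp add: start_at_def)
qed

lemma gap_columns_root: "columns gap_instance gap_parts {} 1 = {start_at 1, start_at 2}"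
proof
  show "columns gap_instance gap_parts {} 1 \<subseteq> {start_at 1, start_at 2}"
  proof
    fix x assume "x \<in> columns gap_instance gap_parts {} 1"
    then have bin: "\<And>a m t. x a m t \<in> {0, 1}"
      and supp: "\<And>a m t. a \<noteq> (0, 0) \<Longrightarrow> x a m t = 0" "\<And>a m t. m \<noteq> 0 \<Longrightarrow> x a m t = 0"
        "\<And>a m t. t \<noteq> 1 \<Longrightarrow> t \<noteq> 2 \<Longrightarrow> x a m t = 0"
      and one: "x (0, 0) 0 1 + x (0, 0) 0 2 = 1"
      by (auto simp: columns_def assignment_def gap_periods simp del: split_paired_All)
    consider "x (0, 0) 0 1 = 1" "x (0, 0) 0 2 = 0" | "x (0, 0) 0 1 = 0" "x (0, 0) 0 2 = 1"
      using bin[of "(0, 0)" 0 1] one by fastforce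
    then show "x \<in> {start_at 1, start_at 2}"
    proof cases
      case 1
      have "x a m t = start_at 1 a m t" for a m t
        by (cases "a = (0, 0)"; cases "m = 0"; cases "t = 1"; cases "t = 2")
           (simp_all add: start_at_def 1[simplified] supp)
      then show ?thesis by blast
    next
      case 2
      have "x a m t = start_at 2 a m t" for a m t
        by (cases "a = (0, 0)"; cases "m = 0"; cases "t = 1"; cases "t = 2")
           (simp_all add: start_at_def 2[simplified] supp)
      then show ?thesis by blast
    qed
  qed
  show "{start_at 1, start_at 2} \<subseteq> columns gap_instance gap_parts {} 1"
    by (auto simp: columns_def assignment_def gap_periods start_at_def disaggregated_prec_def
        precs_within_def)
qed

lemma gap_columns_branch: "columns gap_instance gap_parts {gap_branch} 1 = {start_at 2}"
proof -
  have "columns gap_instance gap_parts {gap_branch} 1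
      = {x \<in> columns gap_instance gap_parts {} 1.
          satisfies_branching gap_instance gap_parts gap_branch x}"
    unfolding columns_def gap_branch_def by (simp add: conj_assoc cong: conj_cong)
  moreover have "\<not> satisfies_branching gap_instance gap_parts gap_branch (start_at 1)"
    and "satisfies_branching gap_instance gap_parts gap_branch (start_at 2)"
    by (simp_all add: gap_branch_def gap_demand_1) (simp_all add: start_at_def)
  ultimately show ?thesis
    unfolding gap_columns_root by auto
qed

lemma gap_branching_node: "branching_node gap_instance 1 gap_parts {gap_branch}"
proof (rule branching_node.branch[OF branching_node.root])
  \<comment> \<open>Starting in period 1 uses two units there, so weight \<open>3/4\<close> gives the demand \<open>3/2\<close>.\<close>
  let ?l = "\<lambda>(_::nat) w. if w = start_at 1 then 3/4 else 1/4 :: real"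
  note cols = gap_columns_root[simplified]
  show "lmp_feasible gap_instance 1 gap_parts {} ?l (\<lambda>_. 2)"
    using start_at_neq gap_valid(4)
    by (auto simp: lmp_feasible_def cols gap_periods gap_demand_1 gap_demand_2 gap_peak_demand
        start_at_def)
  show "\<exists>n'\<in>{1..1}. \<exists>w\<in>columns gap_instance gap_parts {} n'. ?l n' w \<notin> {0, 1}"
    using start_at_neq by (intro bexI[of _ 1] bexI[of _ "start_at 1"]) (simp_all add: cols)
  show "3/2 = (\<Sum>w\<in>columns gap_instance gap_parts {} 1.
      demand gap_instance (gap_parts 1) 0 1 w * ?l 1 w)"
    using start_at_neq by (simp add: cols gap_demand_1) (simp add: start_at_def)
  show "gap_branch = Down 0 1 1 (3/2) \<or> gap_branch = Up 0 1 1 (3/2)"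
    by (simp add: gap_branch_def)
qed (simp_all add: gap_periods)

lemma gap_z_LP_root: "0 \<le> z_LP gap_instance gap_parts {}"
  unfolding z_LP_def
  by (rule Inf_greatest)
     (auto simp: lp_feasible_def compact_base_def compact_cost_def gap_schedule_cost gap_periods)

lemma gap_z_LMP_root: "z_LMP gap_instance 1 gap_parts {} \<le> 0"
proof -
  let ?l = "\<lambda>(_::nat) w. if w = start_at 1 then 1 else 0 :: real"
  note cols = gap_columns_root[simplified]
  have "lmp_feasible gap_instance 1 gap_parts {} ?l (\<lambda>_. 2)"
    using start_at_neq gap_valid(4)
    by (auto simp: lmp_feasible_def cols gap_periods gap_demand_1 gap_demand_2 gap_peak_demand
        start_at_def)
  moreover have "master_cost gap_instance 1 gap_parts {} ?l (\<lambda>_. 2) = 0"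
    using start_at_neq by (simp add: master_cost_def cols gap_schedule_cost) (simp add: start_at_def)
  ultimately show ?thesis
    unfolding z_LMP_def by (intro Inf_lower) force
qed

text \<open>Starting half of the activity in each period meets the branching constraint with equality.\<close>

lemma gap_z_LP_branch: "z_LP gap_instance gap_parts {gap_branch} \<le> ereal (1/2)"
proof -
  let ?x = "\<lambda>_ _ _. 1/2 :: real"
  have "lp_feasible gap_instance gap_parts {gap_branch} ?x (\<lambda>_. 2)"
    by (auto simp: lp_feasible_def compact_base_def gap_branch_def assignment_def gap_periods
        gap_demand_1 gap_demand_2 disaggregated_prec_def)
  moreover have "compact_cost gap_instance ?x (\<lambda>_. 2) = 1/2"
    by (simp add: compact_cost_def gap_schedule_cost)
  ultimately show ?thesis
    unfolding z_LP_def by (intro Inf_lower) force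
qed

lemma gap_z_LMP_branch: "z_LMP gap_instance 1 gap_parts {gap_branch} = 1"
proof (rule antisym)
  note cols = gap_columns_branch[simplified]
  have cost: "master_cost gap_instance 1 gap_parts {gap_branch} l R = l 1 (start_at 2)" for l R
    by (simp add: master_cost_def cols gap_schedule_cost) (simp add: start_at_def)
  let ?l = "\<lambda>(_::nat) (_ :: (nat, nat, nat) pulse). 1 :: real"
  have "lmp_feasible gap_instance 1 gap_parts {gap_branch} ?l (\<lambda>_. 2)"
    using gap_valid(4)
    by (auto simp: lmp_feasible_def cols gap_periods gap_demand_1 gap_demand_2 gap_peak_demand
        start_at_def)
  then show "z_LMP gap_instance 1 gap_parts {gap_branch} \<le> 1"
    unfolding z_LMP_def using cost[of ?l "\<lambda>_. 2"] by (intro Inf_lower) (force simp: one_ereal_def)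
  show "1 \<le> z_LMP gap_instance 1 gap_parts {gap_branch}"
    unfolding z_LMP_def
    by (rule Inf_greatest) (auto simp: cost[simplified] lmp_feasible_def cols one_ereal_def)
qed

theorem proposition6:
  shows "(\<forall>(I :: ('i, 'j, 'm, 'k) scheduling) N V D.
            valid_instance I \<and> card (modes I) = 1 \<and> is_partition I N V \<and> D \<subseteq> branchings I N \<longrightarrow>
              (cross_precs I N V = {} \<longrightarrow> z_LP I V D \<le> z_LMP I N V D) \<and>
              z_LP_cross_aggregated I N V D \<le> z_LMP I N V D) \<and>
         (\<exists>(I :: (nat, nat, nat, nat) scheduling) N V D.
            valid_instance I \<and> card (modes I) = 1 \<and> is_partition I N V \<and> cross_precs I N V = {} \<and>
            branching_node I N V D \<and>
            z_LP I V {} = z_LMP I N V {} \<and>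
            z_LP I V D < z_LMP I N V D \<and> z_LMP I N V D < \<infinity>)"
proof (intro conjI)
  show "\<forall>(I :: ('i, 'j, 'm, 'k) scheduling) N V D.
          valid_instance I \<and> card (modes I) = 1 \<and> is_partition I N V \<and> D \<subseteq> branchings I N \<longrightarrow>
            (cross_precs I N V = {} \<longrightarrow> z_LP I V D \<le> z_LMP I N V D) \<and>
            z_LP_cross_aggregated I N V D \<le> z_LMP I N V D"
    using z_LP_cross_aggregated_le_z_LMP z_LP_eq_z_LP_cross_aggregated by metis
next
  have "z_LP gap_instance gap_parts {} \<le> z_LMP gap_instance 1 gap_parts {}"
    using z_LP_cross_aggregated_le_z_LMP z_LP_eq_z_LP_cross_aggregated gap_valid
    by (metis empty_subsetI)
  then have root: "z_LP gap_instance gap_parts {} = z_LMP gap_instance 1 gap_parts {}"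
    using gap_z_LP_root gap_z_LMP_root by order
  have "ereal (1/2) < 1"
    by (simp add: one_ereal_def)
  with gap_z_LP_branch
  have gap: "z_LP gap_instance gap_parts {gap_branch} < z_LMP gap_instance 1 gap_parts {gap_branch}"
    unfolding gap_z_LMP_branch by order
  have "z_LMP gap_instance 1 gap_parts {gap_branch} < \<infinity>"
    unfolding gap_z_LMP_branch by simp
  with gap_valid gap_branching_node root gap
  show "\<exists>(I :: (nat, nat, nat, nat) scheduling) N V D.
          valid_instance I \<and> card (modes I) = 1 \<and> is_partition I N V \<and> cross_precs I N V = {} \<and>
          branching_node I N V D \<and>
          z_LP I V {} = z_LMP I N V {} \<and>
          z_LP I V D < z_LMP I N V D \<and> z_LMP I N V D < \<infinity>"
    by blast
qed

end
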